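(* Let $k\ge 3$, let $n>2$, $t\ge 1$ with $n>kt$, and let $\mathtt{Base}$ be a binary consensus protocol for $n>kt$ processes (i.e. a protocol solving binary Byzantine consensus among $n$ processes of which at most $t$ are faulty). Let $\mathtt{CC1}=L_1\odot\mathtt{Base}$ be the composition of the layer $L_1$ with $\mathtt{Base}$. Then $\mathtt{CC1}$ is a binary consensus protocol (every run with at most $t$ faulty processes satisfies Decision, Agreement and Validity) in which: 1. In the unanimous common case (runs in which no process is faulty and $v_i=1$ for every process $i$), all processes decide after 1 round (at time 1) and no messages are sent. 2. In all other runs, at most $n^2$ bits are sent, and 1 round elapses, before reverting to the base protocol.
   Context: **Model.** There is a set $\mathbb{P}=\{0,\dots,n-1\}$ of $n>2$ processes, every pair connected by a reliable two-way link; receivers know the identity of the sender. Time is discrete and global, starting at $0$; round $m+1$ takes place between times $m$ and $m+1$, and a message sent at time $m$ is received by time $m+1$. The local state of process $i$ at time $m$ consists of its initial value $v_i$, the time $m$, and the sequence of its actions so far, including messages sent and received. A protocol is a deterministic function from local states to messages sent and decisions; protocols know $n$ and $t$. In each run a process is either correct (follows the protocol) or faulty (Byzantine: behaves arbitrarily). At most $t$ processes are faulty in each run, where $1\le t<n$. **Consensus.** Each process $i$ starts with $v_i\in V$; in binary consensus $V=\{0,1\}$. A consensus protocol is one all of whose runs (with at most $t$ faulty processes) satisfy: *Decision*: every correct process eventually decides; *Agreement*: all correct processes make the same decision; *Validity*: if all correct processes have the same initial value, then all correct processes decide on this value. **Layer $L_1$ composed with $\mathtt{Base}$** (code of process $i$):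 - Time 0: if $v_i=1$, send nothing; else send an 'err' message to all. - Time 1 and beyond: (a) If no 'err' message was received, decide $1$ and halt (no further actions; in particular do not participate in $\mathtt{Base}$). (b) Otherwise: if at most $t$ 'err' messages were received, decide $1$ (and continue). If at most $2t$ 'err' messages were received, set $est_i:=1$; else set $est_i:=v_i$. Then, starting at time 1, execute $\mathtt{Base}$ with $est_i$ as initial value (time 1 acting as time 0 of $\mathtt{Base}$), letting $\mathsf{dec}$ be the value it decides. If $i$ did not decide at time 1, it decides $\mathsf{dec}$. **Conventions.** "To all" includes the sender itself: a process receives the messages it sends to itself, but these are local and cost no bits. 'err' messages are counted by number of distinct senders, other messages in round 1 are ignored, and an 'err' message costs one bit. Bit counts refer to bits sent by correct processes. "Before reverting to the base protocol" means: in the rounds preceding the start of $\mathtt{Base}$; all communication by correct processes afterwards is that of $\mathtt{Base}$. *)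

theory Defs
  imports Main "HOL-Library.Z2"
begin

text \<open>
  Processes are the numbers below \<open>n\<close>. A mail gives, per peer, the message (if any) on the link
  with that peer in one round; only the entries below \<open>n\<close> have a meaning.
\<close>

type_synonym 'm mail = "nat \<Rightarrow> 'm option"

definition no_mail :: "'m mail" where
  "no_mail = (\<lambda>_. None)"

record ('v, 'm) action =
  decide :: "'v option"
  send :: "'m mail"

text \<open>
  Entry \<open>k\<close> of the history consists of the action taken at time \<open>k\<close> and the mail that is received
  by time \<open>k + 1\<close>.
\<close>

record ('v, 'm) local_state =
  initial :: 'v
  time :: nat
  history :: "(('v, 'm) action \<times> 'm mail) list"

text \<open>
  The first argument is the identity of the process. The parameters \<open>n\<close> and \<open>t\<close> are fixed
  throughout, so a protocol may depend on them.
\<close>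

type_synonym ('v, 'm) protocol = "nat \<Rightarrow> ('v, 'm) local_state \<Rightarrow> ('v, 'm) action"

text \<open>The action of process \<open>i\<close> at time \<open>m\<close> is \<open>act r m i\<close>.\<close>

record ('v, 'm) run =
  faulty :: "nat set"
  inputs :: "nat \<Rightarrow> 'v"
  act :: "nat \<Rightarrow> nat \<Rightarrow> ('v, 'm) action"

definition correct :: "nat \<Rightarrow> ('v, 'm) run \<Rightarrow> nat set" where
  "correct n r = {..<n} - faulty r"

text \<open>The mail received by \<open>i\<close> in the round between times \<open>m\<close> and \<open>m + 1\<close>, its own included.\<close>

definition received :: "nat \<Rightarrow> ('v, 'm) run \<Rightarrow> nat \<Rightarrow> nat \<Rightarrow> 'm mail" where
  "received n r m i = (\<lambda>j. if j < n then send (act r m j) i else None)"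

definition state_at :: "nat \<Rightarrow> ('v, 'm) run \<Rightarrow> nat \<Rightarrow> nat \<Rightarrow> ('v, 'm) local_state" where
  "state_at n r i m =
     \<lparr>initial = inputs r i, time = m,
      history = map (\<lambda>k. (act r k i, received n r k i)) [0..<m]\<rparr>"

definition is_run :: "nat \<Rightarrow> nat \<Rightarrow> ('v, 'm) protocol \<Rightarrow> ('v, 'm) run \<Rightarrow> bool" where
  "is_run n t P r \<longleftrightarrow>
     faulty r \<subseteq> {..<n} \<and> card (faulty r) \<le> t \<and>
     (\<forall>i\<in>correct n r. \<forall>m. act r m i = P i (state_at n r i m))"

text \<open>
  A correct process may repeat its decision; agreement, which includes the case \<open>i = j\<close>, forbids it
  to change it.
\<close>

definition decision :: "nat \<Rightarrow> ('v, 'm) run \<Rightarrow> bool" where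
  "decision n r \<longleftrightarrow> (\<forall>i\<in>correct n r. \<exists>m d. decide (act r m i) = Some d)"

definition agreement :: "nat \<Rightarrow> ('v, 'm) run \<Rightarrow> bool" where
  "agreement n r \<longleftrightarrow>
     (\<forall>i\<in>correct n r. \<forall>j\<in>correct n r. \<forall>m m' d d'.
        decide (act r m i) = Some d \<longrightarrow> decide (act r m' j) = Some d' \<longrightarrow> d = d')"

definition validity :: "nat \<Rightarrow> ('v, 'm) run \<Rightarrow> bool" where
  "validity n r \<longleftrightarrow>
     (\<forall>v. (\<forall>i\<in>correct n r. inputs r i = v) \<longrightarrow>
          (\<forall>i\<in>correct n r. \<exists>m. decide (act r m i) = Some v))"

definition consensus :: "nat \<Rightarrow> nat \<Rightarrow> ('v, 'm) protocol \<Rightarrow> bool" where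
  "consensus n t P \<longleftrightarrow>
     (\<forall>r. is_run n t P r \<longrightarrow> decision n r \<and> agreement n r \<and> validity n r)"

text \<open>
  The local state reached by a process that follows \<open>P\<close> from initial value \<open>v\<close> and receives the
  given mails, one per round.
\<close>

definition replay ::
    "('v, 'm) protocol \<Rightarrow> nat \<Rightarrow> 'v \<Rightarrow> 'm mail list \<Rightarrow> ('v, 'm) local_state" where
  "replay P i v mails =
     fold (\<lambda>x s. s\<lparr>time := Suc (time s), history := history s @ [(P i s, x)]\<rparr>) mails
       \<lparr>initial = v, time = 0, history = []\<rparr>"

lemma state_at_eq_replay:
  assumes "is_run n t P r" and "i \<in> correct n r"
  shows "state_at n r i m = replay P i (inputs r i) (map (\<lambda>k. received n r k i) [0..<m])"
proof (induction m)
  case 0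
  show ?case by (simp add: state_at_def replay_def)
next
  case (Suc m)
  have "act r m i = P i (state_at n r i m)"
    using assms by (auto simp: is_run_def)
  then have "state_at n r i (Suc m) =
      (state_at n r i m)\<lparr>time := Suc (time (state_at n r i m)),
        history := history (state_at n r i m) @
          [(P i (state_at n r i m), received n r m i)]\<rparr>"
    by (simp add: state_at_def)
  then show ?case
    by (simp add: Suc.IH) (simp add: replay_def)
qed

text \<open>
  The distinct processes from which an \<open>err\<close> message arrived in round 1; meant for states at
  time 1 or later.
\<close>

definition err_senders :: "nat \<Rightarrow> 'm \<Rightarrow> ('v, 'm) local_state \<Rightarrow> nat set" where
  "err_senders n err s = {j. j < n \<and> snd (history s ! 0) j = Some err}"

definition est :: "nat \<Rightarrow> nat \<Rightarrow> 'm \<Rightarrow> (bit, 'm) local_state \<Rightarrow> bit" where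
  "est n t err s = (if card (err_senders n err s) \<le> 2 * t then 1 else initial s)"

text \<open>
  The local state of \<open>Base\<close> is recomputed from the estimate and the mails received since time 1.
  It cannot be read off the history: a process that decided at time 1 still runs \<open>Base\<close>, but the
  decision of \<open>Base\<close> is then not an action of the composed protocol.
\<close>

definition CC1 :: "nat \<Rightarrow> nat \<Rightarrow> 'm \<Rightarrow> (bit, 'm) protocol \<Rightarrow> (bit, 'm) protocol" where
  "CC1 n t err Base i s =
     (if time s = 0 then
        \<lparr>decide = None,
         send = (if initial s = 1 then no_mail else (\<lambda>j. if j < n then Some err else None))\<rparr>
      else if err_senders n err s = {} then
        \<lparr>decide = (if time s = 1 then Some 1 else None), send = no_mail\<rparr>
      else
        (let b = Base i (replay Base i (est n t err s) (map snd (tl (history s))))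
         in \<lparr>decide =
               (if card (err_senders n err s) \<le> t
                then (if time s = 1 then Some 1 else None)
                else decide b),
             send = send b\<rparr>))"

definition unanimous_common_case :: "nat \<Rightarrow> (bit, 'm) run \<Rightarrow> bool" where
  "unanimous_common_case n r \<longleftrightarrow> faulty r = {} \<and> (\<forall>i<n. inputs r i = 1)"

definition decides_at :: "('v, 'm) run \<Rightarrow> nat \<Rightarrow> nat \<Rightarrow> bool" where
  "decides_at r i m \<longleftrightarrow>
     decide (act r m i) \<noteq> None \<and> (\<forall>k<m. decide (act r k i) = None)"

text \<open>Bits sent by correct processes before time \<open>m\<close>; messages to oneself are free.\<close>

definition bits_before :: "nat \<Rightarrow> ('m \<Rightarrow> nat) \<Rightarrow> ('v, 'm) run \<Rightarrow> nat \<Rightarrow> nat" where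
  "bits_before n bits r m =
     (\<Sum>k<m. \<Sum>i\<in>correct n r. \<Sum>j\<in>{..<n} - {i}.
        case send (act r k i) j of None \<Rightarrow> 0 | Some x \<Rightarrow> bits x)"

text \<open>
  From time \<open>m\<close> on, taken as time 0 of \<open>P\<close>, process \<open>i\<close> sends exactly the messages prescribed
  by \<open>P\<close> for initial value \<open>v\<close>.
\<close>

definition communicates_as ::
    "nat \<Rightarrow> ('v, 'm) protocol \<Rightarrow> 'v \<Rightarrow> ('v, 'm) run \<Rightarrow> nat \<Rightarrow> nat \<Rightarrow> bool" where
  "communicates_as n P v r i m \<longleftrightarrow>
     (\<forall>k. send (act r (m + k) i) =
        send (P i (replay P i v (map (\<lambda>l. received n r (m + l) i) [0..<k]))))"

definition silent_from :: "('v, 'm) run \<Rightarrow> nat \<Rightarrow> nat \<Rightarrow> bool" where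
  "silent_from r i m \<longleftrightarrow> (\<forall>k\<ge>m. send (act r k i) = no_mail)"

end

theory Submission
  imports Defs
begin

text \<open>
  A correct process hears an \<open>err\<close> from each correct process with input 0 and, beyond these, at
  most from the faulty ones, so the counts of two correct processes differ by at most \<open>t\<close>. If a
  correct process hears none, all correct processes hear at most \<open>t\<close> and decide 1 at time 1.
  Otherwise all of them execute \<open>Base\<close> from time 1 on, and the shifted run is a run of \<open>Base\<close>. If
  one of them decides 1 at time 1, all hear at most \<open>2t\<close>, so the estimates are unanimously 1 and
  \<open>Base\<close> decides 1 as well. If all correct inputs are 0, more than \<open>2t\<close> are heard because
  \<open>n - t > 2t\<close>, and the estimates are unanimously 0.
\<close>

section \<open>Round 1 and the mails fed to \<open>Base\<close>\<close>

definition err_heard :: "nat \<Rightarrow> 'm \<Rightarrow> ('v, 'm) run \<Rightarrow> nat \<Rightarrow> nat set" where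
  "err_heard n err r i = {j. j < n \<and> send (act r 0 j) i = Some err}"

lemma err_senders_state_at:
  assumes "0 < m"
  shows "err_senders n err (state_at n r i m) = err_heard n err r i"
  using assms by (auto simp: err_senders_def err_heard_def state_at_def received_def)

text \<open>Round 1 alone fixes the estimate, so recomputing it at any later time gives the value of
  time 1.\<close>

lemma est_state_at:
  assumes "0 < m"
  shows "est n t err (state_at n r i m) =
    (if card (err_heard n err r i) \<le> 2 * t then 1 else inputs r i)"
  using assms by (simp add: est_def err_senders_state_at) (simp add: state_at_def)

text \<open>Indexed by the time of \<open>Base\<close>, one behind that of the run. It retains the
  decision of \<open>Base\<close> even for a process that decided at time 1 and therefore does not
  output it.\<close>

definition base_action ::
    "nat \<Rightarrow> nat \<Rightarrow> 'm \<Rightarrow> (bit, 'm) protocol \<Rightarrow> (bit, 'm) run \<Rightarrow> nat \<Rightarrow> nat \<Rightarrow> (bit, 'm) action" where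
  "base_action n t err Base r m i =
     Base i (replay Base i (est n t err (state_at n r i 1))
       (map (\<lambda>l. received n r (Suc l) i) [0..<m]))"

lemma mails_after_first_round:
  "map snd (tl (history (state_at n r i (Suc m)))) = map (\<lambda>l. received n r (Suc l) i) [0..<m]"
proof -
  \<comment> \<open>Time \<open>Suc m\<close> of the run is time \<open>m\<close> of
    \<open>Base\<close>: dropping the \<open>err\<close> round leaves \<open>m\<close> mails, with
    indices from 1 on.\<close>
  have "tl [0..<Suc m] = map Suc [0..<m]"
    by (simp add: upt_conv_Cons map_Suc_upt del: upt_Suc)
  then show ?thesis
    by (simp add: state_at_def map_tl [symmetric] comp_def del: upt_Suc)
qed

text \<open>Here the actions are known to come from replayed states, not from the states of the run.
  As a state records past actions, the two have to be identified by induction on time.\<close>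

lemma state_at_replayI:
  assumes "\<And>m. act r m i = P i (replay P i (inputs r i) (map (\<lambda>l. received n r l i) [0..<m]))"
  shows "state_at n r i m = replay P i (inputs r i) (map (\<lambda>l. received n r l i) [0..<m])"
proof (induction m)
  case 0
  show ?case by (simp add: state_at_def replay_def)
next
  case (Suc m)
  have "act r m i = P i (state_at n r i m)"
    using assms Suc.IH by simp
  then have "state_at n r i (Suc m) =
      (state_at n r i m)\<lparr>time := Suc (time (state_at n r i m)),
        history := history (state_at n r i m) @
          [(P i (state_at n r i m), received n r m i)]\<rparr>"
    by (simp add: state_at_def)
  then show ?case
    by (simp add: Suc.IH) (simp add: replay_def)
qed

section \<open>Actions of correct processes\<close>

locale CC1_run =
  fixes n t :: nat and err :: 'm and Base :: "(bit, 'm) protocol" and r :: "(bit, 'm) run"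
  assumes run: "is_run n t (CC1 n t err Base) r"
begin

abbreviation heard where "heard \<equiv> err_heard n err r"
abbreviation estimate where "estimate i \<equiv> est n t err (state_at n r i 1)"

lemma act_CC1: "i \<in> correct n r \<Longrightarrow> act r m i = CC1 n t err Base i (state_at n r i m)"
  using run by (auto simp: is_run_def)

lemma act_0:
  assumes "i \<in> correct n r"
  shows "act r 0 i = \<lparr>decide = None,
    send = (if inputs r i = 1 then no_mail else (\<lambda>j. if j < n then Some err else None))\<rparr>"
  using act_CC1[OF assms, of 0] by (simp add: CC1_def state_at_def)

lemma act_Suc:
  assumes "i \<in> correct n r"
  shows "act r (Suc m) i =
    (if heard i = {} then \<lparr>decide = (if m = 0 then Some 1 else None), send = no_mail\<rparr>
     else \<lparr>decide = (if card (heard i) \<le> t then (if m = 0 then Some 1 else None)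
               else decide (base_action n t err Base r m i)),
            send = send (base_action n t err Base r m i)\<rparr>)"
proof -
  have "time (state_at n r i (Suc m)) = Suc m"
    by (simp add: state_at_def)
  moreover have "est n t err (state_at n r i (Suc m)) = estimate i"
    by (simp add: est_state_at)
  ultimately show ?thesis
    by (simp add: act_CC1[OF assms] CC1_def err_senders_state_at mails_after_first_round
        base_action_def Let_def)
qed

section \<open>Counting \<open>err\<close> messages\<close>

lemma card_faulty: "finite (faulty r)" "card (faulty r) \<le> t"
  using run finite_subset[of "faulty r" "{..<n}"] by (auto simp: is_run_def)

text \<open>The \<open>err\<close> senders that all correct processes have in common; only faulty
  senders can make two counts differ.\<close>

definition dissenters where "dissenters = {j \<in> correct n r. inputs r j = 0}"

lemma heard_bounds:
  assumes "i \<in> correct n r"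
  shows "card dissenters \<le> card (heard i)" "card (heard i) \<le> card dissenters + t"
proof -
  have fin: "finite (heard i)" "finite dissenters"
    by (auto simp: err_heard_def dissenters_def correct_def)
  have "dissenters \<subseteq> heard i"
    using assms act_0 by (auto simp: err_heard_def dissenters_def correct_def)
  then show "card dissenters \<le> card (heard i)"
    using fin by (simp add: card_mono)
  \<comment> \<open>A correct \<open>err\<close> sender has an input other than 1, which among bits
    means 0.\<close>
  have "heard i \<subseteq> dissenters \<union> faulty r"
    using act_0 by (auto simp: err_heard_def dissenters_def correct_def no_mail_def
        split: if_splits)
  then have "card (heard i) \<le> card (dissenters \<union> faulty r)"
    using fin card_faulty by (simp add: card_mono)
  also have "\<dots> \<le> card dissenters + card (faulty r)"
    by (rule card_Un_le)
  finally show "card (heard i) \<le> card dissenters + t"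
    using card_faulty by linarith
qed

lemma heard_nonempty: "card (heard i) > t \<Longrightarrow> heard i \<noteq> {}"
  by auto

section \<open>Decisions and the embedded run of \<open>Base\<close>\<close>

lemma decide_1_iff_few_heard:
  assumes "i \<in> correct n r" "card (heard i) \<le> t"
  shows "decide (act r m i) = Some d \<longleftrightarrow> m = 1 \<and> d = 1"
  using assms by (cases m) (auto simp: act_0 act_Suc)

lemma decide_iff_many_heard:
  assumes "i \<in> correct n r" "card (heard i) > t"
  shows "decide (act r m i) = Some d \<longleftrightarrow>
    (\<exists>l. m = Suc l \<and> decide (base_action n t err Base r l i) = Some d)"
  using assms heard_nonempty[OF assms(2)] by (cases m) (auto simp: act_0 act_Suc)

text \<open>Correct processes get \<open>base_action\<close> because their actual action may lack
  the decision of \<open>Base\<close>. Faulty ones may do anything, so their actions are merely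
  shifted by one round.\<close>

definition base_run :: "(bit, 'm) run" where
  "base_run = \<lparr>faulty = faulty r, inputs = estimate,
     act = (\<lambda>m i. if i \<in> correct n r then base_action n t err Base r m i else act r (Suc m) i)\<rparr>"

lemma correct_base_run [simp]: "correct n base_run = correct n r"
  by (simp add: base_run_def correct_def)

lemma is_run_base_run:
  assumes "\<And>i. i \<in> correct n r \<Longrightarrow> heard i \<noteq> {}"
  shows "is_run n t Base base_run"
proof -
  \<comment> \<open>Every correct process heard an \<open>err\<close>, so it sends what
    \<open>base_action\<close> prescribes; withheld decisions do not affect the mail.\<close>
  have "received n base_run m i = received n r (Suc m) i" for m i
    using assms by (auto simp: received_def base_run_def act_Suc)
  then have act: "act base_run m i =
      Base i (replay Base i (inputs base_run i) (map (\<lambda>l. received n base_run l i) [0..<m]))"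
    if "i \<in> correct n r" for m i
    using that by (simp add: base_run_def base_action_def)
  have "act base_run m i = Base i (state_at n base_run i m)" if "i \<in> correct n r" for m i
    using act[OF that] state_at_replayI[OF act, OF that] by simp
  then show ?thesis
    using run by (auto simp: is_run_def) (auto simp: base_run_def)
qed

lemma base_spec:
  assumes "consensus n t Base" "\<And>i. i \<in> correct n r \<Longrightarrow> heard i \<noteq> {}"
  shows base_decision:
    "i \<in> correct n r \<Longrightarrow> \<exists>m d. decide (base_action n t err Base r m i) = Some d"
  and base_agreement:
    "\<lbrakk>i \<in> correct n r; j \<in> correct n r; decide (base_action n t err Base r m i) = Some d;
      decide (base_action n t err Base r m' j) = Some d'\<rbrakk> \<Longrightarrow> d = d'"
  and base_validity:
    "\<lbrakk>\<And>j. j \<in> correct n r \<Longrightarrow> estimate j = v; i \<in> correct n r\<rbrakk>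
      \<Longrightarrow> \<exists>m. decide (base_action n t err Base r m i) = Some v"
proof -
  have act: "act base_run m i = base_action n t err Base r m i" if "i \<in> correct n r" for m i
    using that by (simp add: base_run_def)
  have "decision n base_run" "agreement n base_run" "validity n base_run"
    using assms(1) is_run_base_run[OF assms(2)] by (auto simp: consensus_def)
  note spec = this[unfolded decision_def agreement_def validity_def correct_base_run]
  show "\<exists>m d. decide (base_action n t err Base r m i) = Some d" if "i \<in> correct n r"
    using spec(1) that by (metis act)
  show "d = d'" if "i \<in> correct n r" "j \<in> correct n r"
    "decide (base_action n t err Base r m i) = Some d"
    "decide (base_action n t err Base r m' j) = Some d'"
    using spec(2) that by (metis act)
  show "\<exists>m. decide (base_action n t err Base r m i) = Some v"
    if "\<And>j. j \<in> correct n r \<Longrightarrow> estimate j = v" "i \<in> correct n r"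
  proof -
    have "inputs base_run j = v" if "j \<in> correct n r" for j
      using \<open>\<And>j. j \<in> correct n r \<Longrightarrow> estimate j = v\<close>[OF that] by (simp add: base_run_def)
    then show ?thesis
      using spec(3) that(2) by (metis act)
  qed
qed

text \<open>More than \<open>t\<close> senders cannot all be faulty, so some dissenter exists, and
  it sends \<open>err\<close> to everybody.\<close>

lemma all_hear_err:
  assumes "i \<in> correct n r" "card (heard i) > t" "j \<in> correct n r"
  shows "heard j \<noteq> {}"
  using heard_bounds[OF assms(1)] heard_bounds(1)[OF assms(3)] assms(2) by auto

lemma base_decision_1:
  assumes base: "consensus n t Base"
    and i: "i \<in> correct n r" "card (heard i) \<le> t"
    and j: "j \<in> correct n r" "card (heard j) > t"
    and dec: "decide (base_action n t err Base r m j) = Some d"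
  shows "d = 1"
proof -
  note heard = all_hear_err[OF j]
  \<comment> \<open>Since \<open>i\<close> hears every dissenter, there are at most \<open>t\<close>
    of them; adding the faulty senders gives at most \<open>2 * t\<close>.\<close>
  have "estimate l = 1" if "l \<in> correct n r" for l
    using heard_bounds(1)[OF i(1)] heard_bounds(2)[OF that] i(2) by (simp add: est_state_at)
  then obtain m' where "decide (base_action n t err Base r m' j) = Some 1"
    using base_validity[OF base heard] j(1) by blast
  \<comment> \<open>\<open>Base\<close> may decide repeatedly; agreement of \<open>j\<close> with
    itself equates \<open>d\<close> with 1.\<close>
  then show ?thesis
    using base_agreement[OF base heard j(1) j(1) dec] by blast
qed

section \<open>Decision, agreement and validity\<close>

lemma decision_CC1:
  assumes base: "consensus n t Base"
  shows "decision n r"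
  unfolding decision_def
proof
  fix i assume i: "i \<in> correct n r"
  show "\<exists>m d. decide (act r m i) = Some d"
  proof (cases "card (heard i) \<le> t")
    case True
    then show ?thesis by (simp add: decide_1_iff_few_heard i)
  next
    case False
    then have many: "card (heard i) > t" by simp
    show ?thesis
      using base_decision[OF base all_hear_err[OF i many] i]
      by (simp add: decide_iff_many_heard[OF i many]) blast
  qed
qed

lemma agreement_CC1:
  assumes base: "consensus n t Base"
  shows "agreement n r"
  unfolding agreement_def
proof (intro ballI allI impI)
  fix i j m m' d d'
  assume i: "i \<in> correct n r" and j: "j \<in> correct n r"
    and d: "decide (act r m i) = Some d" and d': "decide (act r m' j) = Some d'"
  consider "card (heard i) \<le> t" "card (heard j) \<le> t"
    | "card (heard i) \<le> t" "card (heard j) > t"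
    | "card (heard i) > t" "card (heard j) \<le> t"
    | "card (heard i) > t" "card (heard j) > t"
    by linarith
  then show "d = d'"
  proof cases
    case 1
    then show ?thesis using d d' i j by (simp add: decide_1_iff_few_heard)
  next
    case 2
    then show ?thesis
      using d d' base_decision_1[OF base i _ j]
      by (auto simp: decide_1_iff_few_heard[OF i] decide_iff_many_heard[OF j])
  next
    case 3
    then show ?thesis
      using d d' base_decision_1[OF base j _ i]
      by (auto simp: decide_1_iff_few_heard[OF j] decide_iff_many_heard[OF i])
  next
    case 4
    then show ?thesis
      using d d' base_agreement[OF base all_hear_err[OF i 4(1)] i j]
      by (auto simp: decide_iff_many_heard[OF i] decide_iff_many_heard[OF j])
  qed
qed

lemma validity_CC1:
  assumes base: "consensus n t Base" and n: "n > 3 * t"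
  shows "validity n r"
  unfolding validity_def
proof (intro allI impI ballI)
  fix v i assume v: "\<forall>j\<in>correct n r. inputs r j = v" and i: "i \<in> correct n r"
  show "\<exists>m. decide (act r m i) = Some v"
  proof (cases "v = 1")
    case True
    then have "dissenters = {}" using v by (auto simp: dissenters_def)
    \<comment> \<open>Without dissenters at most \<open>t\<close> \<open>err\<close> messages are
      heard, which triggers the decision 1 at time 1.\<close>
    then show ?thesis
      using heard_bounds(2)[OF i] True by (simp add: decide_1_iff_few_heard i)
  next
    case False
    then have "dissenters = correct n r" using v by (auto simp: dissenters_def)
    moreover have "card (correct n r) \<ge> n - t"
      using diff_card_le_card_Diff[OF card_faulty(1), of "{..<n}"] card_faulty(2)
      by (simp add: correct_def)
    ultimately have "card dissenters \<ge> n - t" by simp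
    \<comment> \<open>Here \<open>n > 3 * t\<close> enters: it gives \<open>n - t > 2 * t\<close>,
      so that every estimate is the input.\<close>
    then have many: "card (heard j) > 2 * t" if "j \<in> correct n r" for j
      using heard_bounds(1)[OF that] n by linarith
    then have mi: "card (heard i) > t" using i by fastforce
    have "estimate j = v" if "j \<in> correct n r" for j
      using many[OF that] v that by (simp add: est_state_at)
    then obtain m where "decide (base_action n t err Base r m i) = Some v"
      using base_validity[OF base all_hear_err[OF i mi]] i by blast
    then show ?thesis
      by (auto simp: decide_iff_many_heard[OF i mi])
  qed
qed

section \<open>Messages and their cost\<close>

lemma silent_if_no_err_heard:
  assumes "i \<in> correct n r" "heard i = {}"
  shows "silent_from r i 1"
  unfolding silent_from_def
proof (intro allI impI)
  fix m :: nat assume "1 \<le> m"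
  then show "send (act r m i) = no_mail"
    using assms by (cases m) (auto simp: act_Suc)
qed

text \<open>Having decided at time 1 changes only the later decisions of a process, not its
  messages.\<close>

lemma communicates_as_Base:
  assumes "i \<in> correct n r" "heard i \<noteq> {}"
  shows "communicates_as n Base (estimate i) r i 1"
  using assms by (simp add: communicates_as_def act_Suc base_action_def)

text \<open>Nobody sends at time 0, so nobody hears an \<open>err\<close>, and everyone decides at
  time 1 and stays silent.\<close>

lemma unanimous_common_case_CC1:
  assumes u: "unanimous_common_case n r" and i: "i < n"
  shows "decides_at r i 1" "send (act r m i) = no_mail"
proof -
  have correct: "correct n r = {..<n}"
    using u by (simp add: correct_def unanimous_common_case_def)
  have act0: "act r 0 j = \<lparr>decide = None, send = no_mail\<rparr>" if "j < n" for j
    using that u act_0[of j] correct by (simp add: unanimous_common_case_def)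
  then have none: "heard i = {}"
    by (auto simp: err_heard_def no_mail_def)
  show "decides_at r i 1"
    using act0[OF i] act_Suc[of i 0] i none correct by (simp add: decides_at_def)
  show "send (act r m i) = no_mail"
    using act0[OF i] act_Suc[of i] i none correct by (cases m) auto
qed

lemma bits_before_1_le:
  assumes "bits err = 1"
  shows "bits_before n bits r 1 \<le> n\<^sup>2"
proof -
  let ?cost = "\<lambda>i j. case send (act r 0 i) j of None \<Rightarrow> 0 | Some x \<Rightarrow> bits x"
  \<comment> \<open>At time 0 a correct process can send only \<open>err\<close>, at one
    bit.\<close>
  have "?cost i j \<le> 1" if "i \<in> correct n r" for i j
    using that assms by (simp add: act_0 no_mail_def)
  then have "bits_before n bits r 1 \<le> (\<Sum>i\<in>correct n r. \<Sum>j\<in>{..<n} - {i}. 1)"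
    by (simp add: bits_before_def sum_mono del: sum_constant)
  also have "\<dots> \<le> (\<Sum>i\<in>correct n r. n)"
    by (intro sum_mono) (simp add: card_Diff_singleton_if)
  also have "\<dots> \<le> (\<Sum>i<n. n)"
    by (intro sum_mono2) (auto simp: correct_def)
  finally show ?thesis by (simp add: power2_eq_square)
qed

end

theorem theorem1:
  fixes k n t :: nat
    and err :: 'm
    and bits :: "'m \<Rightarrow> nat"
    and Base :: "(bit, 'm) protocol"
  assumes "k \<ge> 3" and "n > 2" and "t \<ge> 1" and "n > k * t"
    and "bits err = 1"
    and "consensus n t Base"
  shows "consensus n t (CC1 n t err Base) \<and>
    (\<forall>r. is_run n t (CC1 n t err Base) r \<longrightarrow>
      (if unanimous_common_case n r then
         (\<forall>i<n. decides_at r i 1) \<and>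
         (\<forall>m. \<forall>i<n. \<forall>j<n. send (act r m i) j = None)
       else
         bits_before n bits r 1 \<le> n\<^sup>2 \<and>
         (\<forall>i\<in>correct n r.
            if err_senders n err (state_at n r i 1) = {} then silent_from r i 1
            else communicates_as n Base (est n t err (state_at n r i 1)) r i 1)))"
proof -
  have "3 * t \<le> k * t"
    using assms(1) by simp
  then have n: "n > 3 * t"
    using assms(4) by linarith
  show ?thesis
  proof (intro conjI allI impI)
    show "consensus n t (CC1 n t err Base)"
      unfolding consensus_def
      using CC1_run.decision_CC1 CC1_run.agreement_CC1 CC1_run.validity_CC1 n assms(6)
      by (metis CC1_run.intro)
  next
    fix r assume "is_run n t (CC1 n t err Base) r"
    then interpret CC1_run n t err Base r
      by unfold_locales
    show "if unanimous_common_case n r then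
         (\<forall>i<n. decides_at r i 1) \<and>
         (\<forall>m. \<forall>i<n. \<forall>j<n. send (act r m i) j = None)
       else
         bits_before n bits r 1 \<le> n\<^sup>2 \<and>
         (\<forall>i\<in>correct n r.
            if err_senders n err (state_at n r i 1) = {} then silent_from r i 1
            else communicates_as n Base (est n t err (state_at n r i 1)) r i 1)"
      \<comment> \<open>\<open>err_senders_state_at\<close> turns the test on the local state into
        emptiness of \<open>heard i\<close>, the case split of the two communication lemmas.\<close>
      using unanimous_common_case_CC1 bits_before_1_le[of bits, OF assms(5)] silent_if_no_err_heard
        communicates_as_Base err_senders_state_at[of 1 n err r]
      by (simp add: no_mail_def)
  qed
qed

end
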